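(* Let $n\ge 1$ and let $L$ be an $n$-component link in $\mathbb{R}^3$. Then $$a(L)\ \ge\ b(L)-n,$$ where $a(L)$ is the ascending number of $L$ and $b(L)$ is the bridge number of $L$.
   Context: All knots and links are piecewise linear, in $\mathbb{R}^3$. A link diagram is ordered if an order is given to its components, based if a basepoint (different from the crossing points) is specified on each component, and oriented if an orientation is specified on each component. Given a based ordered oriented link diagram $\tilde L$ of a link $L$, its descending diagram $d(\tilde L)$ is obtained by starting at the basepoint of the first component and traversing it in the direction of its orientation, then doing the same for the remaining components in the given order, and changing crossings as necessary so that every crossing is first encountered as an over-crossing. The ascending number $a(\tilde L)$ of the diagram is the number of crossings at which $\tilde L$ and $d(\tilde L)$ differ. The ascending number $a(L)$ of the link is the minimum of $a(\tilde L)$ over all based ordered oriented diagrams $\tilde L$ of $L$ (all choices of diagram, basepoints, order and orientation). The bridge number $b(L)$ is the minimum, over all links ambient isotopic to $L$ in general position with respect to a height function on $\mathbb{R}^3$, of the number of local maxima of the height function on the link (so an $n$-component trivial link has bridge number $n$). *)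

theory Defs
  imports "HOL-Analysis.Analysis" "HOL-Library.Extended_Nat"
begin

section \<open>Piecewise linear links\<close>

text \<open>Paths are the library's paths, parametrised by \<open>{0..1}\<close>; the finite set \<open>S\<close> contains the
  parameters at which the path may bend.\<close>

definition pl_path :: "(real \<Rightarrow> 'a::real_normed_vector) \<Rightarrow> bool" where
  "pl_path g \<longleftrightarrow> path g \<and>
     (\<exists>S. finite S \<and>
        (\<forall>a b. 0 \<le> a \<and> a < b \<and> b \<le> 1 \<and> {a<..<b} \<inter> S = {} \<longrightarrow>
           (\<exists>c v. \<forall>t\<in>{a..b}. g t = c + t *\<^sub>R v)))"

definition pl_loop :: "(real \<Rightarrow> 'a::real_normed_vector) \<Rightarrow> bool" where
  "pl_loop g \<longleftrightarrow> pl_path g \<and> pathfinish g = pathstart g"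

text \<open>A link is a subset of space; the list \<open>gs\<close> enumerates its components, each with a
  parametrisation (hence an orientation and a starting point).\<close>

definition parametrises_link :: "(real \<Rightarrow> real^3) list \<Rightarrow> (real^3) set \<Rightarrow> bool" where
  "parametrises_link gs L \<longleftrightarrow>
     (\<forall>g\<in>set gs. pl_loop g \<and> simple_path g) \<and>
     (\<forall>i<length gs. \<forall>j<length gs. i \<noteq> j \<longrightarrow> path_image (gs ! i) \<inter> path_image (gs ! j) = {}) \<and>
     L = (\<Union>g\<in>set gs. path_image g)"

definition link_with_components :: "nat \<Rightarrow> (real^3) set \<Rightarrow> bool" where
  "link_with_components n L \<longleftrightarrow> (\<exists>gs. length gs = n \<and> parametrises_link gs L)"

definition ambient_isotopic :: "(real^3) set \<Rightarrow> (real^3) set \<Rightarrow> bool" where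
  "ambient_isotopic L L' \<longleftrightarrow>
     (\<exists>H :: real \<Rightarrow> real^3 \<Rightarrow> real^3.
        continuous_on ({0..1} \<times> UNIV) (\<lambda>(t, x). H t x) \<and>
        (\<forall>t\<in>{0..1}. \<exists>G. homeomorphism UNIV UNIV (H t) G) \<and>
        (\<forall>x. H 0 x = x) \<and> H 1 ` L = L')"

definition height :: "real^3 \<Rightarrow> real" where
  "height x = x $ 3"

section \<open>Bridge number\<close>

text \<open>General position of a piecewise linear link with respect to the height function: the
  height is not constant on any nondegenerate segment of the link.\<close>

definition height_generic :: "(real^3) set \<Rightarrow> bool" where
  "height_generic L \<longleftrightarrow>
     (\<forall>a b. closed_segment a b \<subseteq> L \<and> a \<noteq> b \<longrightarrow> height a \<noteq> height b)"

definition local_maxima :: "(real^3) set \<Rightarrow> (real^3) set" where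
  "local_maxima L = {p \<in> L. \<forall>\<^sub>F q in at p within L. height q \<le> height p}"

text \<open>Minima are taken in \<^typ>\<open>enat\<close>, where the infimum of a nonempty set is attained.\<close>

definition bridge_number :: "(real^3) set \<Rightarrow> enat" where
  "bridge_number L =
     Inf {enat (card (local_maxima L')) | L'.
            ambient_isotopic L L' \<and> (\<exists>m. link_with_components m L') \<and> height_generic L'}"

section \<open>Based ordered oriented link diagrams\<close>

text \<open>The components of a diagram are listed in their order; each is a closed plane curve whose
  parametrisation gives the orientation and whose value at \<open>0\<close> is the basepoint. A position
  \<open>(i, s)\<close> is the point with parameter \<open>s\<close> of the \<open>i\<close>-th component, and \<open>over_at D p\<close> is the
  position on the over-strand at the crossing \<open>p\<close> (its value at other points is irrelevant).\<close>

record diagram =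
  curves :: "(real \<Rightarrow> real^2) list"
  over_at :: "real^2 \<Rightarrow> nat \<times> real"

definition passages :: "diagram \<Rightarrow> real^2 \<Rightarrow> (nat \<times> real) set" where
  "passages D p = {(i, s). i < length (curves D) \<and> 0 \<le> s \<and> s < 1 \<and> (curves D ! i) s = p}"

definition crossings :: "diagram \<Rightarrow> (real^2) set" where
  "crossings D = {p. \<exists>x\<in>passages D p. \<exists>y\<in>passages D p. x \<noteq> y}"

definition straight_at :: "(real \<Rightarrow> real^2) \<Rightarrow> real \<Rightarrow> real^2 \<Rightarrow> bool" where
  "straight_at c s v \<longleftrightarrow> (\<forall>\<^sub>F u in nhds s. c u = c s + (u - s) *\<^sub>R v)"

text \<open>Crossings are finitely many transverse double points in the interiors of edges; the
  condition \<open>0 < s\<close> keeps the basepoints away from them.\<close>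

definition link_diagram :: "diagram \<Rightarrow> bool" where
  "link_diagram D \<longleftrightarrow>
     (\<forall>c\<in>set (curves D). pl_loop c) \<and>
     finite (crossings D) \<and>
     (\<forall>p\<in>crossings D.
        card (passages D p) = 2 \<and>
        over_at D p \<in> passages D p \<and>
        (\<forall>(i, s)\<in>passages D p. 0 < s) \<and>
        (\<forall>(i, s)\<in>passages D p. \<forall>(j, t)\<in>passages D p. (i, s) \<noteq> (j, t) \<longrightarrow>
           (\<exists>v w. straight_at (curves D ! i) s v \<and> straight_at (curves D ! j) t w \<and>
                  \<not> collinear {0, v, w})))"

definition proj_plane :: "real^3 \<Rightarrow> real^2" where
  "proj_plane x = vector [x $ 1, x $ 2]"

definition diagram_of :: "diagram \<Rightarrow> (real^3) set \<Rightarrow> bool" where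
  "diagram_of D L \<longleftrightarrow> link_diagram D \<and>
     (\<exists>L' gs. ambient_isotopic L L' \<and> parametrises_link gs L' \<and>
        length gs = length (curves D) \<and>
        (\<forall>i<length gs. \<forall>s\<in>{0..1}. proj_plane ((gs ! i) s) = (curves D ! i) s) \<and>
        (\<forall>p\<in>crossings D. \<forall>(j, t)\<in>passages D p. (j, t) \<noteq> over_at D p \<longrightarrow>
           (case over_at D p of (i, s) \<Rightarrow> height ((gs ! j) t) < height ((gs ! i) s))))"

section \<open>Ascending number\<close>

definition before :: "nat \<times> real \<Rightarrow> nat \<times> real \<Rightarrow> bool" where
  "before x y \<longleftrightarrow> fst x < fst y \<or> (fst x = fst y \<and> snd x < snd y)"

definition first_passage :: "diagram \<Rightarrow> real^2 \<Rightarrow> nat \<times> real" where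
  "first_passage D p =
     (THE x. x \<in> passages D p \<and> (\<forall>y\<in>passages D p. y \<noteq> x \<longrightarrow> before x y))"

definition descending :: "diagram \<Rightarrow> diagram" where
  "descending D = D\<lparr>over_at := first_passage D\<rparr>"

definition diagram_ascending_number :: "diagram \<Rightarrow> nat" where
  "diagram_ascending_number D =
     card {p \<in> crossings D. over_at D p \<noteq> over_at (descending D) p}"

definition ascending_number :: "(real^3) set \<Rightarrow> enat" where
  "ascending_number L = Inf {enat (diagram_ascending_number D) | D. diagram_of D L}"

end

theory Submission
  imports Defs
begin

text \<open>Let \<open>D\<close> be a diagram of \<open>L\<close>. Keeping the plane curves, replace the height along each component
  by a function that falls from the basepoint almost to the end and then climbs back, with the
  components stacked in their order; this realises the descending diagram with one maximum per
  component. At each crossing where \<open>D\<close> is not descending, a high narrow tent on the later strand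
  restores the crossing of \<open>D\<close> at the cost of one further maximum. The old and the new heights
  order the two strands alike at every crossing, so the new link is the image of the old one under
  a map \<open>(p, z) \<mapsto> (p, \<alpha> p * z + \<beta> p)\<close> with \<open>\<alpha> > 0\<close>, and such a map is joined to the identity by an
  isotopy of the same shape.\<close>

section \<open>Piecewise linear paths\<close>

text \<open>Interpolating between the old and the new heights over fixed plane curves moves only the
  link, whereas \<open>ambient_isotopic\<close> asks for homeomorphisms of the whole space, so an
  isotopy extension argument would be needed. Fibrewise affine maps avoid it, being defined on all
  of space from the start. That a single such map can carry all old heights to the new ones is
  decided at the crossings: there two strands prescribe two values of one affine function of the
  height, whose slope is positive exactly because both height assignments put the same strand on
  top. As the crossings are finitely many, the slopes extend to the plane. These maps need not be
  piecewise linear, but on the link they add the difference of two piecewise linear heights, so the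
  image is again piecewise linear. Finally, the maxima are counted per curve of the diagram, and
  comparing with \<open>n\<close> requires that an ambient isotopy cannot increase the number of
  components.\<close>

lemma pl_pathE:
  assumes "pl_path g"
  obtains S where "finite S" "\<And>a b. 0 \<le> a \<Longrightarrow> a < b \<Longrightarrow> b \<le> 1 \<Longrightarrow> {a<..<b} \<inter> S = {} \<Longrightarrow>
    \<exists>c v. \<forall>t\<in>{a..b}. g t = c + t *\<^sub>R v"
  using assms unfolding pl_path_def by (elim conjE exE) (rule that, assumption, simp)

lemma pl_path_add:
  assumes "pl_path f" "pl_path g"
  shows "pl_path (\<lambda>t. f t + g t)"
proof -
  obtain S where S: "finite S" "\<And>a b. 0 \<le> a \<Longrightarrow> a < b \<Longrightarrow> b \<le> 1 \<Longrightarrow> {a<..<b} \<inter> S = {} \<Longrightarrow>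
      \<exists>c v. \<forall>t\<in>{a..b}. f t = c + t *\<^sub>R v"
    using assms(1) by (elim pl_pathE) (rule that)
  obtain T where T: "finite T" "\<And>a b. 0 \<le> a \<Longrightarrow> a < b \<Longrightarrow> b \<le> 1 \<Longrightarrow> {a<..<b} \<inter> T = {} \<Longrightarrow>
      \<exists>c v. \<forall>t\<in>{a..b}. g t = c + t *\<^sub>R v"
    using assms(2) by (elim pl_pathE) (rule that)
  have "\<exists>c v. \<forall>t\<in>{a..b}. f t + g t = c + t *\<^sub>R v"
    if ab: "0 \<le> a" "a < b" "b \<le> 1" and dj: "{a<..<b} \<inter> (S \<union> T) = {}" for a b
  proof -
    obtain c v where 1: "\<forall>t\<in>{a..b}. f t = c + t *\<^sub>R v" using S(2)[OF ab] dj by blast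
    obtain d w where 2: "\<forall>t\<in>{a..b}. g t = d + t *\<^sub>R w" using T(2)[OF ab] dj by blast
    have "\<forall>t\<in>{a..b}. f t + g t = (c + d) + t *\<^sub>R (v + w)"
      using 1 2 by (simp add: algebra_simps)
    then show ?thesis by blast
  qed
  moreover have "path (\<lambda>t. f t + g t)"
    using assms by (auto simp: pl_path_def path_def intro: continuous_on_add)
  ultimately show ?thesis
    unfolding pl_path_def using S(1) T(1) by (intro conjI exI[of _ "S \<union> T"]) auto
qed

lemma pl_path_linear:
  assumes "pl_path g" "bounded_linear f"
  shows "pl_path (\<lambda>t. f (g t))"
proof -
  interpret f: bounded_linear f by fact
  obtain S where S: "finite S" "\<And>a b. 0 \<le> a \<Longrightarrow> a < b \<Longrightarrow> b \<le> 1 \<Longrightarrow> {a<..<b} \<inter> S = {} \<Longrightarrow>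
      \<exists>c v. \<forall>t\<in>{a..b}. g t = c + t *\<^sub>R v"
    using assms(1) by (elim pl_pathE) (rule that)
  have "\<exists>c v. \<forall>t\<in>{a..b}. f (g t) = c + t *\<^sub>R v"
    if ab: "0 \<le> a" "a < b" "b \<le> 1" and dj: "{a<..<b} \<inter> S = {}" for a b
  proof -
    obtain c v where 1: "\<forall>t\<in>{a..b}. g t = c + t *\<^sub>R v" using S(2)[OF ab] dj by blast
    then have "\<forall>t\<in>{a..b}. f (g t) = f c + t *\<^sub>R f v"
      by (simp add: f.add f.scaleR)
    then show ?thesis by blast
  qed
  moreover have "path (\<lambda>t. f (g t))"
    using assms(1) by (auto simp: pl_path_def path_def intro: f.continuous_on)
  ultimately show ?thesis
    unfolding pl_path_def using S(1) by (intro conjI exI[of _ S]) auto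
qed

lemma pl_path_affine: "pl_path (\<lambda>t. c + t *\<^sub>R v)"
  unfolding pl_path_def path_def by (auto intro!: continuous_intros exI[of _ "{}"])

lemma pl_path_abs: "pl_path (\<lambda>t::real. \<bar>t - c\<bar>)"
proof -
  have "\<exists>d v. \<forall>t\<in>{a..b}. \<bar>t - c\<bar> = d + t *\<^sub>R v" if "a < b" "c \<notin> {a<..<b}" for a b
  proof (cases "c \<le> a")
    case True
    then show ?thesis by (intro exI[of _ "-c"] exI[of _ 1]) auto
  next
    case False
    with that show ?thesis by (intro exI[of _ c] exI[of _ "-1"]) auto
  qed
  then show ?thesis
    unfolding pl_path_def path_def by (auto intro!: continuous_intros exI[of _ "{c}"])
qed

lemma pl_path_sum:
  assumes "\<And>w. w \<in> W \<Longrightarrow> pl_path (f w)"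
  shows "pl_path (\<lambda>t. \<Sum>w\<in>W. f w t)"
  using assms
proof (induction W rule: infinite_finite_induct)
  case (insert w W)
  then show ?case by (simp add: pl_path_add)
qed (use pl_path_affine[of 0 0] in simp_all)

text \<open>The maximum is the mean plus half the absolute difference. For distinct slopes the two
  lines meet at \<open>e\<close>, so the difference is a multiple of \<open>t - e\<close> and there
  is a single bend.\<close>

lemma pl_path_max_affine:
  fixes a b c d :: real
  shows "pl_path (\<lambda>t. max (a + b * t) (c + d * t))"
proof (cases "b = d")
  case True
  then have "(\<lambda>t. max (a + b * t) (c + d * t)) = (\<lambda>t. max a c + t *\<^sub>R b)"
    by (auto simp: max_def algebra_simps)
  then show ?thesis by (simp add: pl_path_affine del: real_scaleR_def)
next
  case False
  define e where "e = (c - a) / (b - d)"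
  have *: "max (a + b * t) (c + d * t) =
      ((a + c) / 2 + t *\<^sub>R ((b + d) / 2)) + (\<bar>b - d\<bar> / 2) * \<bar>t - e\<bar>" for t
  proof -
    have "max x y = (x + y) / 2 + \<bar>x - y\<bar> / 2" for x y :: real
      by (simp add: max_def field_simps)
    moreover have "(a + b * t) - (c + d * t) = (b - d) * (t - e)"
      using False by (simp add: e_def field_simps)
    then have "\<bar>(a + b * t) - (c + d * t)\<bar> = \<bar>b - d\<bar> * \<bar>t - e\<bar>"
      by (simp add: abs_mult)
    ultimately show ?thesis by (simp add: add_divide_distrib algebra_simps)
  qed
  show ?thesis
    unfolding * by (intro pl_path_add pl_path_affine pl_path_linear[OF pl_path_abs]
        bounded_linear_mult_right)
qed

text \<open>A tent is half a second difference of the absolute value, with bends at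
  \<open>w - e\<close>, \<open>w\<close> and \<open>w + e\<close>.\<close>

lemma pl_path_tent:
  fixes w e N :: real
  assumes "e \<ge> 0"
  shows "pl_path (\<lambda>t. N * max 0 (e - \<bar>t - w\<bar>))"
proof -
  have "max 0 (e - \<bar>t - w\<bar>) =
      (1/2) * \<bar>t - (w - e)\<bar> + ((1/2) * \<bar>t - (w + e)\<bar> + (-1) * \<bar>t - w\<bar>)" for t
    using assms by (auto simp: max_def abs_if field_simps)
  then have *: "N * max 0 (e - \<bar>t - w\<bar>) = N * ((1/2) * \<bar>t - (w - e)\<bar> +
      ((1/2) * \<bar>t - (w + e)\<bar> + (-1) * \<bar>t - w\<bar>))" for t by simp
  show ?thesis
    unfolding * by (intro pl_path_linear[OF _ bounded_linear_mult_right] pl_path_add pl_path_abs)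
qed

lemma pl_path_cong:
  assumes "pl_path f" "\<And>t. t \<in> {0..1} \<Longrightarrow> f t = g t"
  shows "pl_path g"
proof -
  obtain S where S: "finite S" "\<And>a b. 0 \<le> a \<Longrightarrow> a < b \<Longrightarrow> b \<le> 1 \<Longrightarrow> {a<..<b} \<inter> S = {} \<Longrightarrow>
      \<exists>c v. \<forall>t\<in>{a..b}. f t = c + t *\<^sub>R v"
    using assms(1) by (elim pl_pathE) (rule that)
  have "\<exists>c v. \<forall>t\<in>{a..b}. g t = c + t *\<^sub>R v"
    if ab: "0 \<le> a" "a < b" "b \<le> 1" "{a<..<b} \<inter> S = {}" for a b
  proof -
    obtain c v where "\<forall>t\<in>{a..b}. f t = c + t *\<^sub>R v" using S(2)[OF ab] by blast
    moreover have "f t = g t" if "t \<in> {a..b}" for t using assms(2) ab that by auto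
    ultimately show ?thesis by auto
  qed
  moreover have "path g"
    using assms continuous_on_cong[of "{0..1}" "{0..1}" f g] by (simp add: pl_path_def path_def)
  ultimately show ?thesis
    unfolding pl_path_def using S(1) by (intro conjI exI[of _ S]) auto
qed

section \<open>Heights with few maxima\<close>

text \<open>The factor 4 leaves room later: if \<open>s\<close> is within \<open>2 * e\<close> of
  one peak and \<open>u\<close> within \<open>e\<close> of \<open>s\<close>, then \<open>u\<close>
  is still at distance at least \<open>e\<close> from every other peak.\<close>

lemma finite_separation:
  fixes A :: "real set"
  assumes "finite A"
  obtains e where "e > 0" "\<And>x y. x \<in> A \<Longrightarrow> y \<in> A \<Longrightarrow> x \<noteq> y \<Longrightarrow> 4 * e \<le> \<bar>x - y\<bar>"
proof -
  \<comment> \<open>The element 1 keeps the minimum defined when \<open>A\<close> has no two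
    distinct points.\<close>
  define D where "D = insert 1 ((\<lambda>(x, y). \<bar>x - y\<bar>) ` {(x, y) \<in> A \<times> A. x \<noteq> y})"
  have "finite {(x, y) \<in> A \<times> A. x \<noteq> y}"
    using assms by (intro finite_subset[OF _ finite_cartesian_product[of A A]]) auto
  then have fin: "finite D" by (simp add: D_def)
  have "Min D > 0"
    using fin by (subst Min_gr_iff) (auto simp: D_def)
  moreover have "Min D \<le> \<bar>x - y\<bar>" if "x \<in> A" "y \<in> A" "x \<noteq> y" for x y
    using fin that by (intro Min_le) (auto simp: D_def)
  ultimately show ?thesis by (intro that[of "Min D / 4"]) auto
qed

text \<open>The maxima are \<open>0\<close> and the points of \<open>W\<close>, the peaks of the tents.\<close>

lemma height_profile:
  fixes P W :: "real set" and M :: real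
  assumes P: "finite P" "P \<subseteq> {0<..<1}" and W: "W \<subseteq> P" and M: "M > 0"
  obtains h :: "real \<Rightarrow> real" where "pl_path h" "h 0 = 0" "h 1 = 0"
    "\<And>s. s \<in> P - W \<Longrightarrow> h s = - s" "\<And>s. s \<in> W \<Longrightarrow> h s \<ge> M - s"
    "\<And>s. s \<in> {0..1} \<Longrightarrow> \<forall>\<^sub>F u in nhds s. u \<noteq> s \<longrightarrow> h u \<noteq> h s"
    "\<And>s. s \<in> {0<..<1} - W \<Longrightarrow>
       (\<forall>\<^sub>F u in nhds s. s < u \<longrightarrow> h s < h u) \<or> (\<forall>\<^sub>F u in nhds s. u < s \<longrightarrow> h s < h u)"
proof -
  obtain e where e: "e > 0"
    and sep: "\<And>x y. x \<in> P \<union> {0,1} \<Longrightarrow> y \<in> P \<union> {0,1} \<Longrightarrow> x \<noteq> y \<Longrightarrow> 4 * e \<le> \<bar>x - y\<bar>"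
    using finite_separation[of "P \<union> {0,1}"] P(1) by (metis finite.simps finite_Un)
  have e4: "4 * e \<le> 1" using sep[of 0 1] by simp
  \<comment> \<open>\<open>N\<close> is the slope of the tents and of the final climb. A tent of
    radius \<open>e\<close> then has height \<open>M + 1\<close>, and \<open>N > 1\<close> makes its
    rising side win against the descent of slope -1.\<close>
  define N where "N = (M + 1) / e"
  have Ne: "N * e = M + 1" using e by (simp add: N_def)
  have N: "N > 1" using e e4 M by (simp add: N_def less_divide_eq)
  \<comment> \<open>\<open>\<tau>\<close> is where the lines \<open>- t\<close> and
    \<open>N * (t - 1)\<close> meet. As \<open>\<tau> \<ge> 1 - e\<close>, the final climb starts to
    the right of all tents.\<close>
  define \<tau> where "\<tau> = N / (1 + N)"
  have \<tau>: "N * \<tau> = N - \<tau>" using N by (simp add: \<tau>_def field_simps)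
  have "(1 - e) * (1 + N) \<le> N" using Ne M e by (simp add: algebra_simps)
  then have \<tau>1: "\<tau> \<ge> 1 - e" using N by (simp add: \<tau>_def pos_le_divide_eq)
  have \<tau>2: "\<tau> < 1" using N by (simp add: \<tau>_def)
  define q where "q t = max (- t) (N * (t - 1))" for t
  define tent where "tent w t = max 0 (e - \<bar>t - w\<bar>)" for w t
  define h where "h t = q t + (\<Sum>w\<in>W. N * tent w t)" for t
  have Nmono: "u - s < N * u - N * s" if "s < u" for s u
  proof -
    have "1 * (u - s) < N * (u - s)" using N that by (intro mult_strict_right_mono) auto
    then show ?thesis by (simp add: algebra_simps)
  qed
  have q_left: "q t = - t" if "t \<le> \<tau>" for t
    using Nmono[of t \<tau>] \<tau> that by (cases "t = \<tau>") (auto simp: q_def max_def algebra_simps)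
  have q_right: "q t = N * t - N" if "t \<ge> \<tau>" for t
    using Nmono[of \<tau> t] \<tau> that by (cases "t = \<tau>") (auto simp: q_def max_def algebra_simps)
  have finW: "finite W" using W P(1) finite_subset by blast
  have P_bounds: "4 * e \<le> w \<and> w \<le> 1 - 4 * e" if "w \<in> P" for w
    using sep[of w 0] sep[of w 1] that P(2) by force
  have tent0: "tent w t = 0" if "\<bar>t - w\<bar> \<ge> e" for w t
    using that by (simp add: tent_def)
  have T: "t \<le> w - e \<Longrightarrow> tent w t = 0" "w + e \<le> t \<Longrightarrow> tent w t = 0"
    "w - e \<le> t \<Longrightarrow> t \<le> w \<Longrightarrow> tent w t = e + t - w"
    "w \<le> t \<Longrightarrow> t \<le> w + e \<Longrightarrow> tent w t = e + w - t" for w t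
    by (auto simp: tent_def)
  have h_far: "h t = q t" if "\<And>w. w \<in> W \<Longrightarrow> \<bar>t - w\<bar> \<ge> e" for t
    using that by (simp add: h_def tent0)
  have h_near: "h t = q t + N * tent w t"
    if "w \<in> W" "\<And>v. v \<in> W \<Longrightarrow> v \<noteq> w \<Longrightarrow> \<bar>t - v\<bar> \<ge> e" for t w
  proof -
    have "(\<Sum>w\<in>W. N * tent w t) = N * tent w t + (\<Sum>v\<in>W - {w}. N * tent v t)"
      using finW that(1) by (rule sum.remove)
    also have "(\<Sum>v\<in>W - {w}. N * tent v t) = 0"
      using that(2) by (intro sum.neutral) (auto simp: tent0)
    finally show ?thesis by (simp add: h_def)
  qed
  have ord: "\<forall>\<^sub>F u in nhds s. (s < c \<longrightarrow> u < c) \<and> (c < s \<longrightarrow> c < u)" for s c :: real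
  proof -
    have "((\<lambda>u. u) \<longlongrightarrow> s) (nhds s)" by (rule filterlim_ident)
    from order_tendstoD[OF this] show ?thesis
      by (cases s c rule: linorder_cases) auto
  qed
  \<comment> \<open>The supports of the tents are separated from each other and from the final
    climb, so near any \<open>s\<close> the function is either \<open>q\<close> alone or the descent
    with one tent.\<close>
  have local: "(\<forall>\<^sub>F u in nhds s. h u = q u) \<or>
      (\<exists>w\<in>W. s < \<tau> \<and> (\<forall>\<^sub>F u in nhds s. h u = - u + N * tent w u))" for s
  proof (cases "\<exists>w\<in>W. \<bar>s - w\<bar> < 2 * e")
    case True
    then obtain w where w: "w \<in> W" "\<bar>s - w\<bar> < 2 * e" by blast
    have s: "s < \<tau>" using w subsetD[OF W w(1)] P_bounds[of w] \<tau>1 e by linarith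
    have "\<forall>\<^sub>F u in nhds s. u \<in> {s - e<..<s + e}"
      using e by (intro eventually_nhds_in_open) auto
    then have "\<forall>\<^sub>F u in nhds s. h u = - u + N * tent w u"
      using ord[of s \<tau>]
    proof eventually_elim
      case (elim u)
      have "\<bar>u - v\<bar> \<ge> e" if "v \<in> W" "v \<noteq> w" for v
      proof -
        have "4 * e \<le> \<bar>v - w\<bar>" using sep[of v w] that w W by blast
        moreover have "\<bar>u - s\<bar> < e" using elim(1) by auto
        ultimately show ?thesis using w(2) by arith
      qed
      then show ?case using h_near[OF w(1), of u] q_left[of u] elim s by auto
    qed
    then show ?thesis using w s by blast
  next
    case False
    have "\<forall>\<^sub>F u in nhds s. u \<in> {s - e<..<s + e}"
      using e by (intro eventually_nhds_in_open) auto
    then have "\<forall>\<^sub>F u in nhds s. h u = q u"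
    proof eventually_elim
      case (elim u)
      have "\<bar>u - v\<bar> \<ge> e" if "v \<in> W" for v
        using False that elim by fastforce
      then show ?case by (rule h_far)
    qed
    then show ?thesis ..
  qed
  show ?thesis
  proof
    have "pl_path q"
      using pl_path_max_affine[of 0 "-1" "- N" N] unfolding q_def by (simp add: algebra_simps)
    then show "pl_path h"
      unfolding h_def tent_def using e by (intro pl_path_add pl_path_sum pl_path_tent) auto
    show "h 0 = 0"
      using h_far[of 0] q_left[of 0] \<tau>1 e e4 W P_bounds by force
    have "e \<le> \<bar>1 - w\<bar>" if "w \<in> W" for w using that W P_bounds[of w] e by auto
    then show "h 1 = 0"
      using h_far[of 1] q_right[of 1] \<tau>2 by auto
    show "h s = - s" if s: "s \<in> P - W" for s
    proof -
      have "e \<le> \<bar>s - w\<bar>" if "w \<in> W" for w using sep[of s w] that s W e by fastforce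
      then show ?thesis using h_far[of s] q_left[of s] P_bounds[of s] s \<tau>1 e by auto
    qed
    show "h s \<ge> M - s" if s: "s \<in> W" for s
    proof -
      have "e \<le> \<bar>s - w\<bar>" if "w \<in> W" "w \<noteq> s" for w using sep[of s w] that s W e by fastforce
      then have "h s = - s + N * e"
        using h_near[of s s] q_left[of s] P_bounds[of s] s W \<tau>1 e by (auto simp: tent_def)
      then show ?thesis using Ne by simp
    qed
    \<comment> \<open>The slopes that occur are -1, \<open>N\<close>, \<open>N - 1\<close> and
      \<open>- N - 1\<close>, none of them zero. The intervals below are closed at the end that
      matches the side from which \<open>u\<close> approaches \<open>s\<close>.\<close>
    show "\<forall>\<^sub>F u in nhds s. u \<noteq> s \<longrightarrow> h u \<noteq> h s" if "s \<in> {0..1}" for s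
      using local[of s]
    proof (elim disjE bexE conjE)
      assume *: "\<forall>\<^sub>F u in nhds s. h u = q u"
      show ?thesis
        using * ord[of s \<tau>]
      proof eventually_elim
        case (elim u)
        have hs: "h s = q s" using eventually_nhds_x_imp_x[OF *] .
        show ?case
        proof (cases u s rule: linorder_cases)
          case less
          then show ?thesis
            using elim hs N Nmono[OF less] by (cases "s \<le> \<tau>") (simp_all add: q_left q_right)
        next
          case greater
          then show ?thesis
            using elim hs N Nmono[OF greater] by (cases "s < \<tau>") (simp_all add: q_left q_right)
        qed simp
      qed
    next
      fix w assume w: "w \<in> W" "s < \<tau>" and *: "\<forall>\<^sub>F u in nhds s. h u = - u + N * tent w u"
      show ?thesis
        using * ord[of s "w - e"] ord[of s w] ord[of s "w + e"]
      proof eventually_elim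
        case (elim u)
        have hs: "h s = - s + N * tent w s" using eventually_nhds_x_imp_x[OF *] .
        show ?case
        proof (cases u s rule: linorder_cases)
          case less
          consider "s \<le> w - e" | "w - e < s" "s \<le> w" | "w < s" "s \<le> w + e" | "w + e < s"
            by linarith
          then show ?thesis
            by cases (use elim hs e Nmono[OF less] less in \<open>simp_all add: T algebra_simps\<close>)
        next
          case greater
          consider "s < w - e" | "w - e \<le> s" "s < w" | "w \<le> s" "s < w + e" | "w + e \<le> s"
            by linarith
          then show ?thesis
            by cases (use elim hs e Nmono[OF greater] greater in \<open>simp_all add: T algebra_simps\<close>)
        qed simp
      qed
    qed
    show "(\<forall>\<^sub>F u in nhds s. s < u \<longrightarrow> h s < h u) \<or> (\<forall>\<^sub>F u in nhds s. u < s \<longrightarrow> h s < h u)"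
      if s: "s \<in> {0<..<1} - W" for s
      using local[of s]
    proof (elim disjE bexE conjE)
      assume *: "\<forall>\<^sub>F u in nhds s. h u = q u"
      have hs: "h s = q s" using eventually_nhds_x_imp_x[OF *] .
      show ?thesis
      proof (cases "s < \<tau>")
        case True
        have "\<forall>\<^sub>F u in nhds s. u < s \<longrightarrow> h s < h u"
          using * by eventually_elim (use True hs q_left in auto)
        then show ?thesis ..
      next
        case False
        have "\<forall>\<^sub>F u in nhds s. s < u \<longrightarrow> h s < h u"
          using * by eventually_elim (use False hs q_right Nmono in fastforce)
        then show ?thesis ..
      qed
    next
      fix w assume w: "w \<in> W" "s < \<tau>" and *: "\<forall>\<^sub>F u in nhds s. h u = - u + N * tent w u"
      have hs: "h s = - s + N * tent w s" using eventually_nhds_x_imp_x[OF *] .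
      have "s \<noteq> w" using w s by auto
      show ?thesis
      \<comment> \<open>This is the rising side of the tent, where the climb is to the right.
        Everywhere else, the peak excepted, larger values lie to the left.\<close>
      proof (cases "w - e \<le> s \<and> s < w")
        case True
        have "\<forall>\<^sub>F u in nhds s. s < u \<longrightarrow> h s < h u"
          using * ord[of s w]
        proof eventually_elim
          case (elim u)
          then show ?case using hs True Nmono[of s u]
            by (cases "s < u") (simp_all add: T algebra_simps)
        qed
        then show ?thesis ..
      next
        case False
        have "\<forall>\<^sub>F u in nhds s. u < s \<longrightarrow> h s < h u"
          using * ord[of s "w - e"] ord[of s w] ord[of s "w + e"]
        proof eventually_elim
          case (elim u)
          show ?case
          proof
            assume "u < s"
            consider "s < w - e" | "w < s" "s \<le> w + e" | "w + e < s"
              using False \<open>s \<noteq> w\<close> by linarith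
            then show "h s < h u"
              by cases (use elim hs e Nmono[OF \<open>u < s\<close>] \<open>u < s\<close> in \<open>simp_all add: T algebra_simps\<close>)
          qed
        qed
        then show ?thesis ..
      qed
    qed
  qed
qed

section \<open>Parametrised links: images, level sets and local maxima\<close>

lemma parametrises_link_path:
  assumes "parametrises_link gs L" "i < length gs"
  shows "path (gs ! i)"
  using assms nth_mem[OF assms(2)] by (auto simp: parametrises_link_def simple_path_def)

lemma parametrises_link_subset:
  assumes "parametrises_link gs L" "i < length gs"
  shows "path_image (gs ! i) \<subseteq> L"
  using assms nth_mem[OF assms(2)] by (auto simp: parametrises_link_def)

lemma parametrises_link_loop:
  assumes "parametrises_link gs L" "i < length gs"
  shows "(gs ! i) 1 = (gs ! i) 0"
  using assms nth_mem[OF assms(2)]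
  by (auto simp: parametrises_link_def pl_loop_def pathfinish_def pathstart_def)

text \<open>\<open>F\<close> itself may fail to be piecewise linear, so piecewise linearity is asked
  only of its composites with the components.\<close>

lemma parametrises_link_image_homeomorphism:
  assumes gs: "parametrises_link gs L" and F: "continuous_on UNIV F" "inj F"
    and pl: "\<And>i. i < length gs \<Longrightarrow> pl_path (F \<circ> gs ! i)"
  shows "parametrises_link (map ((\<circ>) F) gs) (F ` L)"
  unfolding parametrises_link_def
proof (intro conjI ballI allI impI)
  fix g assume "g \<in> set (map ((\<circ>) F) gs)"
  then obtain i where i: "i < length gs" "g = F \<circ> gs ! i" by (auto simp: in_set_conv_nth)
  show "pl_loop g"
    using pl[OF i(1)] parametrises_link_loop[OF gs i(1)]
    by (simp add: pl_loop_def i(2) pathfinish_def pathstart_def)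
  have "simple_path (gs ! i)" using gs nth_mem[OF i(1)] by (simp add: parametrises_link_def)
  then show "simple_path g"
    unfolding i(2)
    by (rule simple_path_continuous_image) (use F in \<open>auto intro: continuous_on_subset inj_on_subset\<close>)
next
  fix i j assume "i < length (map ((\<circ>) F) gs)" "j < length (map ((\<circ>) F) gs)" "i \<noteq> j"
  then have ij: "i < length gs" "j < length gs" "i \<noteq> j" by simp_all
  then have "path_image (gs ! i) \<inter> path_image (gs ! j) = {}"
    using gs by (simp add: parametrises_link_def)
  then show "path_image (map ((\<circ>) F) gs ! i) \<inter> path_image (map ((\<circ>) F) gs ! j) = {}"
    using ij by (simp add: path_image_compose image_Int[OF F(2), symmetric])
next
  show "F ` L = (\<Union>g\<in>set (map ((\<circ>) F) gs). path_image g)"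
    using gs by (auto simp: parametrises_link_def path_image_compose)
qed

text \<open>An infinite level set would be compact and so contain one of its own limit points,
  against isolation.\<close>

lemma finite_level_set:
  fixes h :: "real \<Rightarrow> real"
  assumes h: "continuous_on {0..1} h"
    and isolated: "\<And>s. s \<in> {0..1} \<Longrightarrow> \<forall>\<^sub>F u in nhds s. u \<noteq> s \<longrightarrow> h u \<noteq> h s"
  shows "finite {s \<in> {0..1}. h s = z}"
proof (rule ccontr)
  define A where "A = {s \<in> {0..1}. h s = z}"
  assume "infinite {s \<in> {0..1}. h s = z}"
  then have "infinite A" by (simp add: A_def)
  have "A = {0..1} \<inter> h -` {z}" by (auto simp: A_def)
  then have "closed A"
    using continuous_closed_preimage[OF h, of "{z}"] by simp
  moreover have "{0..1} \<inter> A = A" by (auto simp: A_def)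
  ultimately have "compact A" by (metis compact_Icc compact_Int_closed)
  then obtain s where s: "s \<in> A" "s islimpt A"
    using Heine_Borel_imp_Bolzano_Weierstrass[of A A] \<open>infinite A\<close> by auto
  then have "\<forall>\<^sub>F u in at s. u \<notin> A"
    using isolated[of s] unfolding eventually_at_filter by (auto simp: A_def elim: eventually_mono)
  with s(2) show False by (simp add: islimpt_iff_eventually)
qed

text \<open>Continuity of \<open>g\<close> transports the maximum condition to parameters near
  \<open>s\<close>. A climb on one side suffices, since neither one-sided neighbourhood filter of a
  real is trivial.\<close>

lemma not_local_maximum:
  assumes g: "path g" "path_image g \<subseteq> L" and s: "s \<in> {0<..<1}"
    and climb: "(\<forall>\<^sub>F u in nhds s. s < u \<longrightarrow> height (g s) < height (g u)) \<or>
      (\<forall>\<^sub>F u in nhds s. u < s \<longrightarrow> height (g s) < height (g u))"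
  shows "g s \<notin> local_maxima L"
proof
  assume "g s \<in> local_maxima L"
  then have "\<forall>\<^sub>F q in nhds (g s). q \<noteq> g s \<longrightarrow> q \<in> L \<longrightarrow> height q \<le> height (g s)"
    by (simp add: local_maxima_def eventually_at_filter)
  moreover have "isCont g s"
    using g(1) s by (intro continuous_on_interior[of "{0..1}"]) (auto simp: path_def)
  then have "filterlim g (nhds (g s)) (nhds s)"
    by (simp add: isCont_def tendsto_at_iff_tendsto_nhds)
  ultimately have "\<forall>\<^sub>F u in nhds s. g u \<noteq> g s \<longrightarrow> g u \<in> L \<longrightarrow> height (g u) \<le> height (g s)"
    by (rule eventually_compose_filterlim)
  moreover have "\<forall>\<^sub>F u in nhds s. u \<in> {0<..<1}"
    using s by (intro eventually_nhds_in_open) auto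
  ultimately have *: "\<forall>\<^sub>F u in nhds s. \<not> height (g s) < height (g u)"
  proof eventually_elim
    case (elim u)
    then have "u \<in> {0..1}" by simp
    then have "g u \<in> L" using g(2) by (auto simp: path_image_def)
    then show ?case using elim by fastforce
  qed
  from climb show False
  proof
    assume "\<forall>\<^sub>F u in nhds s. s < u \<longrightarrow> height (g s) < height (g u)"
    with * have "\<forall>\<^sub>F u in nhds s. u \<noteq> s \<longrightarrow> u \<in> {s<..} \<longrightarrow> False" by eventually_elim auto
    then have "\<forall>\<^sub>F u in at_right s. False" by (simp only: eventually_at_filter)
    then show False by simp
  next
    assume "\<forall>\<^sub>F u in nhds s. u < s \<longrightarrow> height (g s) < height (g u)"
    with * have "\<forall>\<^sub>F u in nhds s. u \<noteq> s \<longrightarrow> u \<in> {..<s} \<longrightarrow> False" by eventually_elim auto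
    then have "\<forall>\<^sub>F u in at_left s. False" by (simp only: eventually_at_filter)
    then show False by simp
  qed
qed

lemma parametrises_link_points:
  assumes "parametrises_link gs L" "x \<in> L"
  shows "\<exists>i<length gs. \<exists>s\<in>{0..1}. x = (gs ! i) s"
proof -
  obtain g where "g \<in> set gs" "x \<in> path_image g"
    using assms unfolding parametrises_link_def by blast
  then show ?thesis by (auto simp: path_image_def in_set_conv_nth)
qed

text \<open>A horizontal segment in the link lies in one level set, which is finite because each
  component meets it in finitely many parameters; a nondegenerate segment is infinite.\<close>

lemma height_genericI:
  fixes b :: "nat \<Rightarrow> real \<Rightarrow> real"
  assumes gs: "parametrises_link gs L"
    and heights: "\<And>i s. i < length gs \<Longrightarrow> s \<in> {0..1} \<Longrightarrow> height ((gs ! i) s) = b i s"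
    and cont: "\<And>i. i < length gs \<Longrightarrow> continuous_on {0..1} (b i)"
    and isolated: "\<And>i s. i < length gs \<Longrightarrow> s \<in> {0..1} \<Longrightarrow>
      \<forall>\<^sub>F u in nhds s. u \<noteq> s \<longrightarrow> b i u \<noteq> b i s"
  shows "height_generic L"
  unfolding height_generic_def
proof (intro allI impI notI)
  fix x y assume xy: "closed_segment x y \<subseteq> L \<and> x \<noteq> y" and eq: "height x = height y"
  define A where "A = (\<Union>i\<in>{..<length gs}. (gs ! i) ` {s \<in> {0..1}. b i s = height x})"
  have "finite A"
    unfolding A_def by (intro finite_UN_I finite_imageI finite_level_set cont isolated) auto
  moreover have "closed_segment x y \<subseteq> A"
  proof
    fix z assume z: "z \<in> closed_segment x y"
    then obtain u where u: "z = (1 - u) *\<^sub>R x + u *\<^sub>R y" by (auto simp: in_segment)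
    have z_eq: "height z = height x" using eq unfolding u height_def by (simp add: algebra_simps)
    obtain i s where is': "i < length gs" "s \<in> {0..1}" "z = (gs ! i) s"
      using parametrises_link_points[OF gs] xy z by blast
    then have "b i s = height x" using heights z_eq by simp
    then show "z \<in> A" using is' by (auto simp: A_def)
  qed
  ultimately have "finite (closed_segment x y)" using finite_subset by blast
  then show False using xy by simp
qed

lemma card_local_maxima_le:
  fixes b :: "nat \<Rightarrow> real \<Rightarrow> real"
  assumes gs: "parametrises_link gs L"
    and heights: "\<And>i s. i < length gs \<Longrightarrow> s \<in> {0..1} \<Longrightarrow> height ((gs ! i) s) = b i s"
    and W: "finite W"
    and climb: "\<And>i s. i < length gs \<Longrightarrow> s \<in> {0<..<1} \<Longrightarrow> (i, s) \<notin> W \<Longrightarrow>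
       (\<forall>\<^sub>F u in nhds s. s < u \<longrightarrow> b i s < b i u) \<or> (\<forall>\<^sub>F u in nhds s. u < s \<longrightarrow> b i s < b i u)"
  shows "card (local_maxima L) \<le> length gs + card W"
proof -
  define T where "T = (\<lambda>i. (i, 0)) ` {..<length gs} \<union> W"
  have "local_maxima L \<subseteq> (\<lambda>(i, s). (gs ! i) s) ` T"
  proof
    fix x assume x: "x \<in> local_maxima L"
    then have "x \<in> L" by (simp add: local_maxima_def)
    then obtain i s where is': "i < length gs" "s \<in> {0..1}" "x = (gs ! i) s"
      using parametrises_link_points[OF gs] by blast
    have image: "x \<in> (\<lambda>(i, s). (gs ! i) s) ` T" if "(i, u) \<in> T" "x = (gs ! i) u" for u
      by (rule image_eqI[OF _ that(1)]) (simp add: that(2))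
    show "x \<in> (\<lambda>(i, s). (gs ! i) s) ` T"
    proof (cases "s \<in> {0<..<1}")
      case s: True
      have "(i, s) \<in> W"
      proof (rule ccontr)
        assume "(i, s) \<notin> W"
        have near: "\<forall>\<^sub>F u in nhds s. u \<in> {0<..<1}"
          using s by (intro eventually_nhds_in_open) auto
        have eq: "height ((gs ! i) u) = b i u" if "u \<in> {0<..<1}" for u
          using heights[OF is'(1)] that by simp
        from climb[OF is'(1) s \<open>(i, s) \<notin> W\<close>]
        have "(\<forall>\<^sub>F u in nhds s. s < u \<longrightarrow> height ((gs ! i) s) < height ((gs ! i) u)) \<or>
          (\<forall>\<^sub>F u in nhds s. u < s \<longrightarrow> height ((gs ! i) s) < height ((gs ! i) u))"
        proof (elim disj_forward)
          show "\<forall>\<^sub>F u in nhds s. s < u \<longrightarrow> height ((gs ! i) s) < height ((gs ! i) u)"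
            if "\<forall>\<^sub>F u in nhds s. s < u \<longrightarrow> b i s < b i u"
            using that near by eventually_elim (simp only: eq[OF s] eq)
          show "\<forall>\<^sub>F u in nhds s. u < s \<longrightarrow> height ((gs ! i) s) < height ((gs ! i) u)"
            if "\<forall>\<^sub>F u in nhds s. u < s \<longrightarrow> b i s < b i u"
            using that near by eventually_elim (simp only: eq[OF s] eq)
        qed
        then have "(gs ! i) s \<notin> local_maxima L"
          by (rule not_local_maximum[OF parametrises_link_path[OF gs is'(1)]
                parametrises_link_subset[OF gs is'(1)] s])
        then show False using x is'(3) by simp
      qed
      then show ?thesis using image[of s] is'(3) by (simp add: T_def)
    next
      case False
      \<comment> \<open>Both ends of the parameter interval give the basepoint, so it counts once
        per component.\<close>
      then have "s = 0 \<or> s = 1" using is'(2) by auto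
      then have "x = (gs ! i) 0"
        using is'(3) parametrises_link_loop[OF gs is'(1)] by auto
      then show ?thesis using image[of 0] is'(1) by (simp add: T_def)
    qed
  qed
  moreover have T: "finite T" using W by (simp add: T_def)
  ultimately have "card (local_maxima L) \<le> card T"
    using surj_card_le by blast
  also have "card T \<le> card ((\<lambda>i. (i, 0::real)) ` {..<length gs}) + card W"
    unfolding T_def by (rule card_Un_le)
  also have "\<dots> \<le> length gs + card W"
    using card_image_le[of "{..<length gs}" "\<lambda>i. (i, 0::real)"] by simp
  finally show ?thesis .
qed

section \<open>Heights realising a diagram\<close>

lemma crossingI: "x \<in> passages D p \<Longrightarrow> y \<in> passages D p \<Longrightarrow> x \<noteq> y \<Longrightarrow> p \<in> crossings D"
  by (auto simp: crossings_def)

lemma passages_pair: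
  assumes D: "link_diagram D" and x: "x \<in> passages D p" and y: "y \<in> passages D p" and "x \<noteq> y"
  shows "passages D p = {x, y}"
proof -
  have c: "card (passages D p) = 2"
    using D crossingI[OF x y \<open>x \<noteq> y\<close>] by (simp add: link_diagram_def)
  then have "finite (passages D p)" by (metis card.infinite zero_neq_numeral)
  then show ?thesis
    using card_seteq[of "passages D p" "{x, y}"] c x y \<open>x \<noteq> y\<close> by auto
qed

lemma crossing_over_at:
  assumes "link_diagram D" "p \<in> crossings D"
  shows "over_at D p \<in> passages D p"
  using assms by (simp add: link_diagram_def)

lemma crossing_positions:
  assumes "link_diagram D" "p \<in> crossings D" "(i, s) \<in> passages D p"
  shows "i < length (curves D) \<and> 0 < s \<and> s < 1"
  using assms by (auto simp: link_diagram_def passages_def)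

lemma first_passage_eq:
  assumes "passages D p = {x, y}" "before x y"
  shows "first_passage D p = x"
  unfolding first_passage_def
proof (rule the_equality)
  show "x \<in> passages D p \<and> (\<forall>z\<in>passages D p. z \<noteq> x \<longrightarrow> before x z)"
    using assms by auto
  have "\<not> before y x" using assms(2) by (auto simp: before_def)
  then show "z = x" if "z \<in> passages D p \<and> (\<forall>w\<in>passages D p. w \<noteq> z \<longrightarrow> before z w)" for z
    using that assms by auto
qed

lemma before_total: "x \<noteq> y \<Longrightarrow> before x y \<or> before y x"
  by (cases x; cases y) (auto simp: before_def)

text \<open>Raising a strand at one wrong crossing disturbs no other crossing: a position lies over
  a single plane point, and heights are compared only at crossing positions.\<close>

lemma diagram_height_functions:
  assumes D: "link_diagram D"
  obtains W :: "(nat \<times> real) set" and b :: "nat \<Rightarrow> real \<Rightarrow> real" where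
    "finite W" "card W \<le> diagram_ascending_number D"
    "\<And>i. i < length (curves D) \<Longrightarrow> pl_path (b i)"
    "\<And>i. i < length (curves D) \<Longrightarrow> b i 1 = b i 0"
    "\<And>p i s j t. p \<in> crossings D \<Longrightarrow> over_at D p = (i, s) \<Longrightarrow>
       (j, t) \<in> passages D p \<Longrightarrow> (j, t) \<noteq> (i, s) \<Longrightarrow> b j t < b i s"
    "\<And>i s. i < length (curves D) \<Longrightarrow> s \<in> {0..1} \<Longrightarrow>
       \<forall>\<^sub>F u in nhds s. u \<noteq> s \<longrightarrow> b i u \<noteq> b i s"
    "\<And>i s. i < length (curves D) \<Longrightarrow> s \<in> {0<..<1} \<Longrightarrow> (i, s) \<notin> W \<Longrightarrow>
       (\<forall>\<^sub>F u in nhds s. s < u \<longrightarrow> b i s < b i u) \<or> (\<forall>\<^sub>F u in nhds s. u < s \<longrightarrow> b i s < b i u)"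
proof -
  define m where "m = length (curves D)"
  define wrong where "wrong = {p \<in> crossings D. over_at D p \<noteq> first_passage D p}"
  \<comment> \<open>at a wrong crossing the strand met second lies on top; it is the one to be raised\<close>
  define W where "W = over_at D ` wrong"
  define X where "X = (\<Union>p\<in>crossings D. passages D p)"
  have fin: "finite (crossings D)" using D by (simp add: link_diagram_def)
  have "finite (passages D p)" if "p \<in> crossings D" for p
  proof -
    have "card (passages D p) = 2" using D that by (simp add: link_diagram_def)
    then show ?thesis by (metis card.infinite zero_neq_numeral)
  qed
  then have finX: "finite X" unfolding X_def using fin by blast
  have fin_wrong: "finite wrong" unfolding wrong_def using fin by simp
  have WX: "W \<subseteq> X"
    unfolding W_def X_def wrong_def using crossing_over_at[OF D] by blast
  have card_W: "card W \<le> diagram_ascending_number D"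
    using card_image_le[OF fin_wrong, of "over_at D"]
    by (simp add: W_def diagram_ascending_number_def descending_def wrong_def)
  \<comment> \<open>Before raising, crossing strands have heights between \<open>- 2 * m\<close> and
    0 once the components are stacked. The bound \<open>2 * m + 2\<close> therefore lifts a raised
    strand above all of them, even on the lowest component.\<close>
  define Q where "Q i h \<longleftrightarrow> pl_path h \<and> h 0 = 0 \<and> h 1 = 0 \<and>
      (\<forall>s. (i, s) \<in> X - W \<longrightarrow> h s = - s) \<and> (\<forall>s. (i, s) \<in> W \<longrightarrow> h s \<ge> (2 * real m + 2) - s) \<and>
      (\<forall>s\<in>{0..1}. \<forall>\<^sub>F u in nhds s. u \<noteq> s \<longrightarrow> h u \<noteq> h s) \<and>
      (\<forall>s\<in>{0<..<1}. (i, s) \<notin> W \<longrightarrow>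
        (\<forall>\<^sub>F u in nhds s. s < u \<longrightarrow> h s < h u) \<or> (\<forall>\<^sub>F u in nhds s. u < s \<longrightarrow> h s < h u))"
    for i and h :: "real \<Rightarrow> real"
  have "\<exists>h. Q i h" for i
  proof -
    define P where "P = {s. (i, s) \<in> X}"
    have "P \<subseteq> snd ` X" unfolding P_def by force
    then have "finite P" using finX finite_surj by blast
    moreover have "P \<subseteq> {0<..<1}"
      using crossing_positions[OF D] unfolding P_def X_def by auto
    moreover have "{s. (i, s) \<in> W} \<subseteq> P" using WX by (auto simp: P_def)
    ultimately show ?thesis
    proof (rule height_profile)
      show "2 * real m + 2 > 0" by simp
      fix h :: "real \<Rightarrow> real"
      assume "pl_path h" "h 0 = 0" "h 1 = 0"
        "\<And>s. s \<in> P - {s. (i, s) \<in> W} \<Longrightarrow> h s = - s"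
        "\<And>s. s \<in> {s. (i, s) \<in> W} \<Longrightarrow> h s \<ge> (2 * real m + 2) - s"
        "\<And>s. s \<in> {0..1} \<Longrightarrow> \<forall>\<^sub>F u in nhds s. u \<noteq> s \<longrightarrow> h u \<noteq> h s"
        "\<And>s. s \<in> {0<..<1} - {s. (i, s) \<in> W} \<Longrightarrow>
           (\<forall>\<^sub>F u in nhds s. s < u \<longrightarrow> h s < h u) \<or> (\<forall>\<^sub>F u in nhds s. u < s \<longrightarrow> h s < h u)"
      then show ?thesis by (intro exI[of _ h]) (auto simp: P_def Q_def)
    qed
  qed
  then obtain h where Q: "\<And>i. Q i (h i)" by metis
  have h: "\<And>i. pl_path (h i)" "\<And>i. h i 0 = 0" "\<And>i. h i 1 = 0"
      "\<And>i s. (i, s) \<in> X \<Longrightarrow> (i, s) \<notin> W \<Longrightarrow> h i s = - s"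
      "\<And>i s. (i, s) \<in> W \<Longrightarrow> h i s \<ge> (2 * real m + 2) - s"
    and h_iso: "\<And>i s. s \<in> {0..1} \<Longrightarrow> \<forall>\<^sub>F u in nhds s. u \<noteq> s \<longrightarrow> h i u \<noteq> h i s"
    and h_climb: "\<And>i s. s \<in> {0<..<1} \<Longrightarrow> (i, s) \<notin> W \<Longrightarrow>
        (\<forall>\<^sub>F u in nhds s. s < u \<longrightarrow> h i s < h i u) \<or> (\<forall>\<^sub>F u in nhds s. u < s \<longrightarrow> h i s < h i u)"
    using Q by (auto simp: Q_def)
  \<comment> \<open>At unraised crossing positions each profile takes values in the open interval
    from -1 to 0, so a spacing of 2 puts every earlier component above every later one.\<close>
  define b where "b i s = h i s + (- 2 * real i)" for i s
  show ?thesis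
  proof (rule that[of W b])
    show "finite W" using WX finX finite_subset by blast
    show "card W \<le> diagram_ascending_number D" by (rule card_W)
    show "pl_path (b i)" for i
      unfolding b_def using pl_path_add[OF h(1) pl_path_affine[of "- 2 * real i" 0]] by simp
    show "b i 1 = b i 0" for i by (simp add: b_def h)
    show "b j t < b i s"
      if p: "p \<in> crossings D" and over: "over_at D p = (i, s)" and jt: "(j, t) \<in> passages D p"
        and ne: "(j, t) \<noteq> (i, s)" for p i s j t
    proof -
      have is': "(i, s) \<in> passages D p" using crossing_over_at[OF D p] over by simp
      have pass: "passages D p = {(j, t), (i, s)}"
        by (rule passages_pair[OF D jt is' ne])
      have bounds: "i < m" "0 < s" "s < 1" "j < m" "0 < t" "t < 1"
        using crossing_positions[OF D p is'] crossing_positions[OF D p jt] by (simp_all add: m_def)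
      have unique: "p' = p" if "x \<in> passages D p'" "x \<in> passages D p" for x p'
        using that by (auto simp: passages_def)
      \<comment> \<open>Only over-strands are raised, so the lower strand keeps its descending
        height.\<close>
      have "(j, t) \<notin> W"
      proof
        assume "(j, t) \<in> W"
        then obtain p' where p': "p' \<in> wrong" "over_at D p' = (j, t)" by (auto simp: W_def)
        then have "(j, t) \<in> passages D p'"
          using crossing_over_at[OF D, of p'] by (simp add: wrong_def)
        then have "p' = p" using unique jt by blast
        then show False using p'(2) over ne by simp
      qed
      then have bj: "b j t = - t - 2 * real j"
        using h(4)[of j t] p jt by (auto simp: b_def X_def)
      show ?thesis
      proof (cases "p \<in> wrong")
        case True
        then have "(i, s) \<in> W" using over by (force simp: W_def)
        then have "b i s \<ge> (2 * real m + 2) - s - 2 * real i"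
          using h(5)[of i s] by (simp add: b_def)
        moreover have "real i \<le> real m - 1" using bounds by linarith
        moreover have "real j \<ge> 0" by simp
        ultimately show ?thesis using bj bounds by linarith
      next
        case False
        have "(i, s) \<notin> W"
        proof
          assume "(i, s) \<in> W"
          then obtain p' where p': "p' \<in> wrong" "over_at D p' = (i, s)" by (auto simp: W_def)
          then have "(i, s) \<in> passages D p'"
            using crossing_over_at[OF D, of p'] by (simp add: wrong_def)
          then have "p' = p" using unique is' by blast
          then show False using p'(1) False by simp
        qed
        then have bi: "b i s = - s - 2 * real i"
          using h(4)[of i s] p is' by (auto simp: b_def X_def)
        have "first_passage D p = (i, s)" using False p over by (simp add: wrong_def)
        then have "\<not> before (j, t) (i, s)"
          using first_passage_eq[OF pass] ne by auto
        then have "before (i, s) (j, t)" using before_total[OF ne] by blast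
        then consider "i < j" | "i = j" "s < t" by (auto simp: before_def)
        then show ?thesis
        proof cases
          case 1
          then have "real i + 1 \<le> real j" by linarith
          then show ?thesis using bi bj bounds by linarith
        qed (use bi bj in simp)
      qed
    qed
    show "\<forall>\<^sub>F u in nhds s. u \<noteq> s \<longrightarrow> b i u \<noteq> b i s" if "s \<in> {0..1}" for i s
      using h_iso[OF that, of i] by (simp add: b_def)
    show "(\<forall>\<^sub>F u in nhds s. s < u \<longrightarrow> b i s < b i u) \<or> (\<forall>\<^sub>F u in nhds s. u < s \<longrightarrow> b i s < b i u)"
      if "s \<in> {0<..<1}" "(i, s) \<notin> W" for i s
      using h_climb[OF that] by (simp add: b_def)
  qed
qed

section \<open>Fibrewise affine isotopies\<close>

text \<open>Composing the two isotopies at equal times, instead of running them in succession, gives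
  joint continuity without any gluing.\<close>

lemma ambient_isotopic_trans:
  assumes "ambient_isotopic L L'" "ambient_isotopic L' L''"
  shows "ambient_isotopic L L''"
proof -
  obtain H :: "real \<Rightarrow> real^3 \<Rightarrow> real^3" where H: "continuous_on ({0..1} \<times> UNIV) (\<lambda>(t, x). H t x)"
    "\<forall>t\<in>{0..1}. \<exists>G. homeomorphism UNIV UNIV (H t) G" "\<forall>x. H 0 x = x" "H 1 ` L = L'"
    using assms(1) unfolding ambient_isotopic_def by blast
  obtain K :: "real \<Rightarrow> real^3 \<Rightarrow> real^3" where K: "continuous_on ({0..1} \<times> UNIV) (\<lambda>(t, x). K t x)"
    "\<forall>t\<in>{0..1}. \<exists>G. homeomorphism UNIV UNIV (K t) G" "\<forall>x. K 0 x = x" "K 1 ` L' = L''"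
    using assms(2) unfolding ambient_isotopic_def by blast
  have "continuous_on ({0..1} \<times> UNIV) ((\<lambda>(t, x). K t x) \<circ> (\<lambda>z. (fst z, (\<lambda>(t, x). H t x) z)))"
    by (intro continuous_on_compose continuous_intros H(1) continuous_on_subset[OF K(1)]) auto
  then have "continuous_on ({0..1} \<times> UNIV) (\<lambda>(t, x). K t (H t x))"
    by (simp add: o_def case_prod_unfold)
  moreover have "\<exists>G. homeomorphism UNIV UNIV (\<lambda>x. K t (H t x)) G" if "t \<in> {0..1}" for t
    using bspec[OF H(2) that] bspec[OF K(2) that] homeomorphism_compose[of UNIV UNIV "H t" _ UNIV "K t"]
    by (auto simp: o_def)
  ultimately show ?thesis
    unfolding ambient_isotopic_def using H(3,4) K(3,4)
    by (intro exI[of _ "\<lambda>t x. K t (H t x)"]) (auto simp: image_image)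
qed

text \<open>Over \<open>p\<close>, height \<open>z\<close> goes to
  \<open>(1 + t * (\<alpha> p - 1)) * z + t * \<beta> p\<close>: the straight-line interpolation
  from the identity at \<open>t = 0\<close> to \<open>\<alpha> p * z + \<beta> p\<close> at
  \<open>t = 1\<close>.\<close>

definition fibre_map :: "(real^2 \<Rightarrow> real) \<Rightarrow> (real^2 \<Rightarrow> real) \<Rightarrow> real \<Rightarrow> real^3 \<Rightarrow> real^3" where
  "fibre_map \<alpha> \<beta> t x =
     x + (t * ((\<alpha> (proj_plane x) - 1) * height x + \<beta> (proj_plane x))) *\<^sub>R axis 3 1"

lemma proj_plane_eq_iff: "proj_plane x = proj_plane y \<longleftrightarrow> x $ 1 = y $ 1 \<and> x $ 2 = y $ 2"
  by (auto simp: proj_plane_def vec_eq_iff forall_2)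

lemma continuous_on_proj_plane [continuous_intros]:
  assumes "continuous_on A f"
  shows "continuous_on A (\<lambda>x. proj_plane (f x))"
proof -
  have "proj_plane x = (x $ 1) *\<^sub>R axis 1 1 + (x $ 2) *\<^sub>R axis 2 1" for x
    by (auto simp: proj_plane_def vec_eq_iff forall_2 axis_def)
  then show ?thesis using assms by (auto intro!: continuous_intros)
qed

lemma continuous_on_height [continuous_intros]:
  "continuous_on A f \<Longrightarrow> continuous_on A (\<lambda>x. height (f x))"
  unfolding height_def by (intro continuous_intros)

lemma proj_plane_add_axis3 [simp]: "proj_plane (x + c *\<^sub>R axis 3 1) = proj_plane x"
  by (simp add: proj_plane_eq_iff axis_def)

lemma height_add_axis3 [simp]: "height (x + c *\<^sub>R axis 3 1) = height x + c"
  by (simp add: height_def axis_def)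

text \<open>The coefficient of the height is a convex combination of 1 and
  \<open>\<alpha> p\<close>, hence positive, so each vertical line is mapped bijectively and the
  inverse is explicit.\<close>

lemma homeomorphism_fibre_map:
  fixes \<alpha> \<beta> :: "real^2 \<Rightarrow> real"
  assumes \<alpha>: "continuous_on UNIV \<alpha>" and \<beta>: "continuous_on UNIV \<beta>"
    and pos: "\<And>p. \<alpha> p > 0" and t: "t \<in> {0..1}"
  shows "\<exists>G. homeomorphism UNIV UNIV (fibre_map \<alpha> \<beta> t) G"
proof -
  define m where "m p = 1 + t * (\<alpha> p - 1)" for p
  have m_pos: "m p > 0" for p
  proof (cases "t = 1")
    case False
    then have "m p \<ge> 1 - t" "1 - t > 0"
      using t pos[of p] by (auto simp: m_def algebra_simps)
    then show ?thesis by linarith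
  qed (use pos in \<open>simp add: m_def\<close>)
  then have m_nz: "m p \<noteq> 0" for p by (metis less_irrefl)
  have cont: "continuous_on UNIV (\<lambda>x. \<alpha> (proj_plane x))" "continuous_on UNIV (\<lambda>x. \<beta> (proj_plane x))"
    by (auto intro!: continuous_intros continuous_on_compose2[OF \<alpha>] continuous_on_compose2[OF \<beta>])
  define G where "G y = y + ((height y - t * \<beta> (proj_plane y)) / m (proj_plane y) - height y) *\<^sub>R axis 3 1"
    for y :: "real^3"
  have "homeomorphism UNIV UNIV (fibre_map \<alpha> \<beta> t) G"
  proof (rule homeomorphismI)
    show "continuous_on UNIV (fibre_map \<alpha> \<beta> t)"
      unfolding fibre_map_def by (intro continuous_intros cont)
    show "continuous_on UNIV G"
      unfolding G_def
      by (intro continuous_intros cont) (auto simp: m_nz, auto simp: m_def intro!: continuous_intros cont)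
    have hf: "height (fibre_map \<alpha> \<beta> t x) = m (proj_plane x) * height x + t * \<beta> (proj_plane x)" for x
      by (simp add: fibre_map_def) (simp add: m_def algebra_simps)
    have ext: "x = y" if "proj_plane x = proj_plane y" "height x = height y" for x y :: "real^3"
      using that unfolding proj_plane_eq_iff by (simp add: height_def vec_eq_iff forall_3)
    have pf: "proj_plane (fibre_map \<alpha> \<beta> t x) = proj_plane x" "proj_plane (G x) = proj_plane x" for x
      by (simp_all add: fibre_map_def G_def)
    have hG: "height (G y) = (height y - t * \<beta> (proj_plane y)) / m (proj_plane y)" for y
      by (simp add: G_def)
    show "G (fibre_map \<alpha> \<beta> t x) = x" for x
      by (rule ext) (simp_all add: pf hG hf m_nz)
    show "fibre_map \<alpha> \<beta> t (G x) = x" for x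
      by (rule ext) (simp_all add: pf hG hf m_nz)
  qed auto
  then show ?thesis by blast
qed

lemma ambient_isotopic_fibre_map:
  assumes \<alpha>: "continuous_on UNIV \<alpha>" and \<beta>: "continuous_on UNIV \<beta>" and pos: "\<And>p. \<alpha> p > 0"
  shows "ambient_isotopic L (fibre_map \<alpha> \<beta> 1 ` L)"
proof -
  have cont: "continuous_on ({0..1} \<times> UNIV) (\<lambda>(t, x). fibre_map \<alpha> \<beta> t x)"
    unfolding fibre_map_def case_prod_unfold
    by (intro continuous_intros continuous_on_compose2[OF \<alpha>] continuous_on_compose2[OF \<beta>]) auto
  show ?thesis
    unfolding ambient_isotopic_def
  proof (intro exI[of _ "fibre_map \<alpha> \<beta>"] conjI ballI)
    show "\<exists>G. homeomorphism UNIV UNIV (fibre_map \<alpha> \<beta> t) G" if "t \<in> {0..1}" for t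
      by (rule homeomorphism_fibre_map[OF assms that])
  qed (simp_all add: cont fibre_map_def)
qed

text \<open>A continuous map from a compact space to a Hausdorff space is closed, hence a quotient
  map onto its image. This turns continuity along the parameter into continuity on a curve that may
  cross itself.\<close>

lemma continuous_on_compact_quotient:
  fixes f :: "'a::topological_space \<Rightarrow> 'b::t2_space" and g :: "'b \<Rightarrow> 'c::topological_space"
  assumes K: "compact K" and f: "continuous_on K f" and gf: "continuous_on K (\<lambda>x. g (f x))"
  shows "continuous_on (f ` K) g"
proof -
  have "closed (g -` B \<inter> f ` K)" if "closed B" for B
  proof -
    obtain A where A: "closed A" "A \<inter> K = (\<lambda>x. g (f x)) -` B \<inter> K"
      using gf \<open>closed B\<close> unfolding continuous_on_closed_invariant by blast
    have "compact (A \<inter> K)" using closed_Int_compact[OF A(1) K] .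
    moreover have "g -` B \<inter> f ` K = f ` (A \<inter> K)" unfolding A(2) by auto
    ultimately show ?thesis
      using compact_continuous_image[of "A \<inter> K" f] continuous_on_subset[OF f]
      by (auto intro!: compact_imp_closed)
  qed
  moreover have "closed (f ` K)" using compact_continuous_image[OF f K] by (rule compact_imp_closed)
  ultimately show ?thesis by (simp add: continuous_on_closed_vimage)
qed

text \<open>The two heights at a crossing fix \<open>\<alpha>\<close> there; once \<open>\<alpha>\<close> is extended to the plane, \<open>\<beta>\<close> is
  determined on the curves and single-valued at the crossings.\<close>

lemma fibrewise_affine_interpolation:
  fixes a b :: "nat \<Rightarrow> real \<Rightarrow> real"
  assumes D: "link_diagram D"
    and a: "\<And>i. i < length (curves D) \<Longrightarrow> continuous_on {0..1} (a i)"
    and b: "\<And>i. i < length (curves D) \<Longrightarrow> continuous_on {0..1} (b i)"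
    and a1: "\<And>i. i < length (curves D) \<Longrightarrow> a i 1 = a i 0"
    and b1: "\<And>i. i < length (curves D) \<Longrightarrow> b i 1 = b i 0"
    and a_less: "\<And>p i s j t. p \<in> crossings D \<Longrightarrow> over_at D p = (i, s) \<Longrightarrow>
       (j, t) \<in> passages D p \<Longrightarrow> (j, t) \<noteq> (i, s) \<Longrightarrow> a j t < a i s"
    and b_less: "\<And>p i s j t. p \<in> crossings D \<Longrightarrow> over_at D p = (i, s) \<Longrightarrow>
       (j, t) \<in> passages D p \<Longrightarrow> (j, t) \<noteq> (i, s) \<Longrightarrow> b j t < b i s"
  obtains \<alpha> \<beta> :: "real^2 \<Rightarrow> real" where
    "continuous_on UNIV \<alpha>" "continuous_on UNIV \<beta>" "\<And>p. \<alpha> p > 0"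
    "\<And>i s. i < length (curves D) \<Longrightarrow> s \<in> {0..1} \<Longrightarrow>
       \<alpha> ((curves D ! i) s) * a i s + \<beta> ((curves D ! i) s) = b i s"
proof -
  define av where "av = (\<lambda>(i, s). a i s)"
  define bv where "bv = (\<lambda>(i, s). b i s)"
  define under where "under p = (SOME x. x \<in> passages D p \<and> x \<noteq> over_at D p)" for p
  have under: "under p \<in> passages D p" "under p \<noteq> over_at D p"
      "passages D p = {over_at D p, under p}" if "p \<in> crossings D" for p
  proof -
    have "\<exists>x. x \<in> passages D p \<and> x \<noteq> over_at D p"
      using that unfolding crossings_def by blast
    from someI_ex[OF this] show *: "under p \<in> passages D p" "under p \<noteq> over_at D p"
      by (simp_all add: under_def)
    then show "passages D p = {over_at D p, under p}"
      using passages_pair[OF D crossing_over_at[OF D that] *(1)] *(2) by auto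
  qed
  have less: "av (under p) < av (over_at D p)" "bv (under p) < bv (over_at D p)"
    if "p \<in> crossings D" for p
  proof -
    obtain i s where o: "over_at D p = (i, s)" by fastforce
    obtain j t where u: "under p = (j, t)" by fastforce
    have jt: "(j, t) \<in> passages D p" "(j, t) \<noteq> (i, s)" using under(1,2)[OF that] o u by simp_all
    show "av (under p) < av (over_at D p)" "bv (under p) < bv (over_at D p)"
      using a_less[OF that o jt] b_less[OF that o jt] by (simp_all add: o u av_def bv_def)
  qed
  \<comment> \<open>The ratio of the new to the old height gap at a crossing, positive because both
    gaps are.\<close>
  define r where "r p = (bv (over_at D p) - bv (under p)) / (av (over_at D p) - av (under p))" for p
  have "finite (crossings D)" using D by (simp add: link_diagram_def)
  then have "closed (crossings D)" "continuous_on (crossings D) (\<lambda>p. ln (r p))"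
    by (simp_all add: finite_imp_closed continuous_on_finite)
  \<comment> \<open>Extending the logarithm instead of the ratio keeps the extension positive after
    exponentiation.\<close>
  then obtain g where g: "continuous_on UNIV g" "\<And>p. p \<in> crossings D \<Longrightarrow> g p = ln (r p)"
    using Tietze_unbounded[of "crossings D" "\<lambda>p. ln (r p)" UNIV] by auto
  define \<alpha> where "\<alpha> p = exp (g p)" for p
  have \<alpha>: "continuous_on UNIV \<alpha>" unfolding \<alpha>_def by (intro continuous_intros g)
  have \<alpha>_cross: "\<alpha> p * (av (over_at D p) - av (under p)) = bv (over_at D p) - bv (under p)"
    if "p \<in> crossings D" for p
    using less[OF that] g(2)[OF that] by (simp add: \<alpha>_def r_def)
  \<comment> \<open>The choice of passage is immaterial by \<open>same\<close>: at a crossing the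
    slope was chosen to make both strands give the same offset.\<close>
  define \<beta>0 where "\<beta>0 p = bv (SOME x. x \<in> passages D p) - \<alpha> p * av (SOME x. x \<in> passages D p)" for p
  have same: "bv x - \<alpha> p * av x = bv y - \<alpha> p * av y"
    if x: "x \<in> passages D p" and y: "y \<in> passages D p" for x y p
  proof (cases "x = y")
    case False
    have p: "p \<in> crossings D" using crossingI[OF x y False] .
    then show ?thesis
      using \<alpha>_cross[OF p] under(3)[OF p] x y False by (auto simp: algebra_simps)
  qed simp
  have loop: "path (curves D ! i)" "(curves D ! i) 1 = (curves D ! i) 0" if "i < length (curves D)" for i
    using D that nth_mem[OF that]
    by (auto simp: link_diagram_def pl_loop_def pl_path_def pathfinish_def pathstart_def)
  have \<beta>0_less: "\<beta>0 ((curves D ! i) s) = b i s - \<alpha> ((curves D ! i) s) * a i s"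
    if i: "i < length (curves D)" and s: "s \<in> {0..<1}" for i s
  proof -
    let ?p = "(curves D ! i) s"
    have "(i, s) \<in> passages D ?p" using i s by (simp add: passages_def)
    from same[OF someI[of "\<lambda>x. x \<in> passages D ?p", OF this] this] show ?thesis
      by (simp add: \<beta>0_def av_def bv_def)
  qed
  \<comment> \<open>Passages only have parameters below 1; the endpoint is recovered from the
    closing up of curves and heights.\<close>
  have \<beta>0: "\<beta>0 ((curves D ! i) s) = b i s - \<alpha> ((curves D ! i) s) * a i s"
    if i: "i < length (curves D)" and s: "s \<in> {0..1}" for i s
    using \<beta>0_less[OF i, of s] \<beta>0_less[OF i, of 0] a1[OF i] b1[OF i] loop(2)[OF i] s
    by (cases "s = 1") auto
  define C where "C = (\<Union>i\<in>{..<length (curves D)}. (curves D ! i) ` {0..1})"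
  have cont_c: "continuous_on {0..1} (curves D ! i)" if "i < length (curves D)" for i
    using loop(1)[OF that] by (simp add: path_def)
  have closed_c: "closed ((curves D ! i) ` {0..1})" if "i < length (curves D)" for i
    using cont_c[OF that] by (intro compact_imp_closed compact_continuous_image) auto
  have "continuous_on C \<beta>0"
    unfolding C_def
  proof (rule continuous_on_closed_Union)
    fix i assume "i \<in> {..<length (curves D)}"
    then have i: "i < length (curves D)" by simp
    show "closed ((curves D ! i) ` {0..1})" by (rule closed_c[OF i])
    have "continuous_on {0..1} (\<lambda>s. b i s - \<alpha> ((curves D ! i) s) * a i s)"
      by (intro continuous_intros a[OF i] b[OF i] continuous_on_compose2[OF \<alpha> cont_c[OF i]]) auto
    then have "continuous_on {0..1} (\<lambda>s. \<beta>0 ((curves D ! i) s))"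
      by (rule iffD2[OF continuous_on_cong[OF refl \<beta>0[OF i]], rotated])
    then show "continuous_on ((curves D ! i) ` {0..1}) \<beta>0"
      by (intro continuous_on_compact_quotient cont_c[OF i]) auto
  qed auto
  moreover have "closed C" unfolding C_def using closed_c by (intro closed_UN) auto
  ultimately obtain \<beta> where \<beta>: "continuous_on UNIV \<beta>" "\<And>p. p \<in> C \<Longrightarrow> \<beta> p = \<beta>0 p"
    using Tietze_unbounded[of C \<beta>0 UNIV] by auto
  show ?thesis
  proof (rule that[OF \<alpha> \<beta>(1)])
    show "\<alpha> p > 0" for p by (simp add: \<alpha>_def)
    show "\<alpha> ((curves D ! i) s) * a i s + \<beta> ((curves D ! i) s) = b i s"
      if "i < length (curves D)" "s \<in> {0..1}" for i s
    proof -
      have "(curves D ! i) s \<in> C" unfolding C_def using that by blast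
      then show ?thesis using \<beta>(2) \<beta>0[OF that] by simp
    qed
  qed
qed

lemma realise_heights:
  fixes b :: "nat \<Rightarrow> real \<Rightarrow> real"
  assumes D: "link_diagram D" and gs: "parametrises_link gs L"
    and len: "length gs = length (curves D)"
    and proj: "\<And>i s. i < length gs \<Longrightarrow> s \<in> {0..1} \<Longrightarrow> proj_plane ((gs ! i) s) = (curves D ! i) s"
    and over: "\<And>p i s j t. p \<in> crossings D \<Longrightarrow> over_at D p = (i, s) \<Longrightarrow>
       (j, t) \<in> passages D p \<Longrightarrow> (j, t) \<noteq> (i, s) \<Longrightarrow> height ((gs ! j) t) < height ((gs ! i) s)"
    and b_pl: "\<And>i. i < length gs \<Longrightarrow> pl_path (b i)"
    and b_loop: "\<And>i. i < length gs \<Longrightarrow> b i 1 = b i 0"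
    and b_over: "\<And>p i s j t. p \<in> crossings D \<Longrightarrow> over_at D p = (i, s) \<Longrightarrow>
       (j, t) \<in> passages D p \<Longrightarrow> (j, t) \<noteq> (i, s) \<Longrightarrow> b j t < b i s"
  obtains L' gs' where "ambient_isotopic L L'" "parametrises_link gs' L'" "length gs' = length gs"
    "\<And>i s. i < length gs \<Longrightarrow> s \<in> {0..1} \<Longrightarrow> height ((gs' ! i) s) = b i s"
proof -
  have g_pl: "pl_path (gs ! i)" if "i < length gs" for i
    using gs nth_mem[OF that] by (simp add: parametrises_link_def pl_loop_def)
  have height_cont: "continuous_on {0..1} (\<lambda>s. height ((gs ! i) s))" if "i < length gs" for i
    using parametrises_link_path[OF gs that] by (intro continuous_on_height) (simp add: path_def)
  have height_loop: "height ((gs ! i) 1) = height ((gs ! i) 0)" if "i < length gs" for i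
    by (simp only: parametrises_link_loop[OF gs that])
  have b_cont: "continuous_on {0..1} (b i)" if "i < length gs" for i
    using b_pl[OF that] by (simp add: pl_path_def path_def)
  obtain \<alpha> \<beta> :: "real^2 \<Rightarrow> real" where
    \<alpha>\<beta>: "continuous_on UNIV \<alpha>" "continuous_on UNIV \<beta>" "\<And>p. \<alpha> p > 0"
    and fit: "\<And>i s. i < length gs \<Longrightarrow> s \<in> {0..1} \<Longrightarrow>
       \<alpha> ((curves D ! i) s) * height ((gs ! i) s) + \<beta> ((curves D ! i) s) = b i s"
    by (rule fibrewise_affine_interpolation[OF D, folded len,
          where a = "\<lambda>i s. height ((gs ! i) s)" and b = b])
      ((rule height_cont b_cont height_loop b_loop over b_over; assumption)+, rule that, assumption+)
  define F where "F = fibre_map \<alpha> \<beta> 1"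
  obtain G where G: "homeomorphism UNIV UNIV F G"
    using homeomorphism_fibre_map[OF \<alpha>\<beta>, of 1] unfolding F_def by auto
  have F_inj: "inj F" by (rule inj_on_inverseI[of _ G]) (rule homeomorphism_apply1[OF G])
  have F_cont: "continuous_on UNIV F" using G by (simp add: homeomorphism_def)
  have F_eq: "F ((gs ! i) s) = (gs ! i) s + (b i s - height ((gs ! i) s)) *\<^sub>R axis 3 1"
    if "i < length gs" "s \<in> {0..1}" for i s
    using fit[OF that] by (simp add: F_def fibre_map_def proj[OF that] algebra_simps)
  have F_pl: "pl_path (F \<circ> gs ! i)" if i: "i < length gs" for i
  proof -
    \<comment> \<open>Removing the old height is linear in the point, so the displaced path is a sum
      of piecewise linear paths.\<close>
    have "bounded_linear (\<lambda>x. (- height x) *\<^sub>R (axis 3 1 :: real^3))"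
      unfolding height_def by (intro bounded_linear_intros bounded_linear_minus bounded_linear_vec_nth)
    then have "pl_path (\<lambda>s. (gs ! i) s + (b i s *\<^sub>R axis 3 1 + (- height ((gs ! i) s)) *\<^sub>R axis 3 1))"
      by (intro pl_path_add g_pl[OF i] pl_path_linear[OF b_pl[OF i]] pl_path_linear[OF g_pl[OF i]]
          bounded_linear_scaleR_left)
    then show ?thesis
      by (rule pl_path_cong) (simp add: i F_eq algebra_simps)
  qed
  show ?thesis
  proof
    show "ambient_isotopic L (F ` L)"
      unfolding F_def by (rule ambient_isotopic_fibre_map[OF \<alpha>\<beta>])
    show "parametrises_link (map ((\<circ>) F) gs) (F ` L)"
      by (rule parametrises_link_image_homeomorphism[OF gs F_cont F_inj F_pl])
    show "length (map ((\<circ>) F) gs) = length gs" by simp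
    show "height ((map ((\<circ>) F) gs ! i) s) = b i s" if "i < length gs" "s \<in> {0..1}" for i s
      using that by (simp add: F_eq)
  qed
qed

section \<open>Components under ambient isotopy\<close>

lemma connected_subset_disjoint_family:
  fixes B :: "nat \<Rightarrow> 'a::topological_space set"
  assumes C: "connected C" "C \<noteq> {}" "C \<subseteq> (\<Union>j<m. B j)"
    and B: "\<And>j. j < m \<Longrightarrow> closed (B j)"
    and disj: "\<And>i j. i < m \<Longrightarrow> j < m \<Longrightarrow> i \<noteq> j \<Longrightarrow> B i \<inter> B j = {}"
  shows "\<exists>j<m. C \<subseteq> B j"
proof -
  obtain x j where j: "j < m" "x \<in> C" "x \<in> B j" using C(2,3) by blast
  define R where "R = (\<Union>i\<in>{..<m} - {j}. B i)"
  have "closed R" unfolding R_def using B by (intro closed_UN) auto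
  moreover have "C \<subseteq> B j \<union> R" using C(3) unfolding R_def by auto
  moreover have "B j \<inter> R \<inter> C = {}" unfolding R_def using disj j(1) by blast
  ultimately have "R \<inter> C = {}"
    using connected_closedD[OF C(1), of "B j" R] B[OF j(1)] j(2,3) by blast
  with \<open>C \<subseteq> B j \<union> R\<close> j(1) show ?thesis by blast
qed

text \<open>Each component is connected, so its image lies in one component of the target. The
  induced map on indices is surjective because \<open>f\<close> is.\<close>

lemma parametrises_link_image:
  assumes gs: "parametrises_link gs L" and L': "parametrises_link gs' L'"
    and f: "continuous_on L f" "f ` L = L'"
  shows "length gs' \<le> length gs"
proof -
  have L'_eq: "L' = (\<Union>j<length gs'. path_image (gs' ! j))"
    using L' by (auto simp: parametrises_link_def set_conv_nth)
  have L_eq: "L = (\<Union>i<length gs. path_image (gs ! i))"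
    using gs by (auto simp: parametrises_link_def set_conv_nth)
  have "\<exists>j<length gs'. f ` path_image (gs ! i) \<subseteq> path_image (gs' ! j)" if i: "i < length gs" for i
  proof (rule connected_subset_disjoint_family)
    show "connected (f ` path_image (gs ! i))"
      using parametrises_link_path[OF gs i] parametrises_link_subset[OF gs i] f(1)
      by (intro connected_continuous_image connected_path_image) (auto intro: continuous_on_subset)
    show "f ` path_image (gs ! i) \<subseteq> (\<Union>j<length gs'. path_image (gs' ! j))"
      using parametrises_link_subset[OF gs i] f(2) L'_eq by blast
    show "path_image (gs' ! i) \<inter> path_image (gs' ! j) = {}"
      if "i < length gs'" "j < length gs'" "i \<noteq> j" for i j
      using L' that by (simp add: parametrises_link_def)
  qed (auto intro: closed_path_image parametrises_link_path[OF L'])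
  then obtain k where k: "\<And>i. i < length gs \<Longrightarrow> k i < length gs'"
      "\<And>i. i < length gs \<Longrightarrow> f ` path_image (gs ! i) \<subseteq> path_image (gs' ! k i)" by metis
  have "{..<length gs'} \<subseteq> k ` {..<length gs}"
  proof
    fix j assume "j \<in> {..<length gs'}"
    then have j: "j < length gs'" by simp
    obtain y where y: "y \<in> path_image (gs' ! j)" using path_image_nonempty by blast
    then have "y \<in> f ` L" using parametrises_link_subset[OF L' j] f(2) by blast
    then obtain i where i: "i < length gs" "y \<in> f ` path_image (gs ! i)" using L_eq by blast
    then have "y \<in> path_image (gs' ! k i)" using k(2) by blast
    then have "k i = j"
      using y L' j k(1)[OF i(1)] unfolding parametrises_link_def by blast
    then show "j \<in> k ` {..<length gs}" using i(1) by blast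
  qed
  then have "card {..<length gs'} \<le> card {..<length gs}"
    using surj_card_le[of "{..<length gs}"] by blast
  then show ?thesis by simp
qed

lemma ambient_isotopic_length_le:
  assumes "ambient_isotopic L L'" "parametrises_link gs L" "parametrises_link gs' L'"
  shows "length gs' \<le> length gs"
proof -
  obtain H where "\<forall>t\<in>{0..1::real}. \<exists>G. homeomorphism UNIV UNIV (H t) G" and L': "H 1 ` L = L'"
    using assms(1) unfolding ambient_isotopic_def by blast
  then have "continuous_on UNIV (H 1)" by (auto simp: homeomorphism_def)
  then show ?thesis
    using parametrises_link_image[OF assms(2,3) _ L'] continuous_on_subset by blast
qed

section \<open>The bridge number and the ascending number\<close>

lemma diagram_ofE:
  assumes "diagram_of D L"
  obtains L' gs where "ambient_isotopic L L'" "parametrises_link gs L'"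
    "length gs = length (curves D)"
    "\<And>i s. i < length gs \<Longrightarrow> s \<in> {0..1} \<Longrightarrow> proj_plane ((gs ! i) s) = (curves D ! i) s"
    "\<And>p i s j t. p \<in> crossings D \<Longrightarrow> over_at D p = (i, s) \<Longrightarrow>
       (j, t) \<in> passages D p \<Longrightarrow> (j, t) \<noteq> (i, s) \<Longrightarrow> height ((gs ! j) t) < height ((gs ! i) s)"
proof -
  obtain L' gs where *: "ambient_isotopic L L'" "parametrises_link gs L'"
    "length gs = length (curves D)"
    and proj: "\<forall>i<length gs. \<forall>s\<in>{0..1}. proj_plane ((gs ! i) s) = (curves D ! i) s"
    and heights: "\<forall>p\<in>crossings D. \<forall>(j, t)\<in>passages D p. (j, t) \<noteq> over_at D p \<longrightarrow>
         (case over_at D p of (i, s) \<Rightarrow> height ((gs ! j) t) < height ((gs ! i) s))"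
    using assms unfolding diagram_of_def by blast
  show ?thesis
  proof (rule that[OF *])
    show "proj_plane ((gs ! i) s) = (curves D ! i) s" if "i < length gs" "s \<in> {0..1}" for i s
      using proj that by blast
    show "height ((gs ! j) t) < height ((gs ! i) s)"
      if "p \<in> crossings D" "over_at D p = (i, s)" "(j, t) \<in> passages D p" "(j, t) \<noteq> (i, s)"
      for p i s j t
      using bspec[OF bspec[OF heights that(1)] that(3)] that(2,4) by simp
  qed
qed

lemma bridge_number_le_diagram:
  assumes "diagram_of D L"
  shows "bridge_number L \<le> enat (diagram_ascending_number D + length (curves D))"
proof -
  have D: "link_diagram D" using assms by (simp add: diagram_of_def)
  obtain L' gs where LL': "ambient_isotopic L L'" and gs: "parametrises_link gs L'"
    and len: "length gs = length (curves D)"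
    and proj: "\<And>i s. i < length gs \<Longrightarrow> s \<in> {0..1} \<Longrightarrow> proj_plane ((gs ! i) s) = (curves D ! i) s"
    and over: "\<And>p i s j t. p \<in> crossings D \<Longrightarrow> over_at D p = (i, s) \<Longrightarrow>
       (j, t) \<in> passages D p \<Longrightarrow> (j, t) \<noteq> (i, s) \<Longrightarrow> height ((gs ! j) t) < height ((gs ! i) s)"
    by (rule diagram_ofE[OF assms]) (rule that, assumption+)
  obtain W :: "(nat \<times> real) set" and b :: "nat \<Rightarrow> real \<Rightarrow> real" where
    W: "finite W" "card W \<le> diagram_ascending_number D"
    and b_pl: "\<And>i. i < length gs \<Longrightarrow> pl_path (b i)"
    and b_loop: "\<And>i. i < length gs \<Longrightarrow> b i 1 = b i 0"
    and b_over: "\<And>p i s j t. p \<in> crossings D \<Longrightarrow> over_at D p = (i, s) \<Longrightarrow>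
       (j, t) \<in> passages D p \<Longrightarrow> (j, t) \<noteq> (i, s) \<Longrightarrow> b j t < b i s"
    and b_iso: "\<And>i s. i < length gs \<Longrightarrow> s \<in> {0..1} \<Longrightarrow> \<forall>\<^sub>F u in nhds s. u \<noteq> s \<longrightarrow> b i u \<noteq> b i s"
    and b_climb: "\<And>i s. i < length gs \<Longrightarrow> s \<in> {0<..<1} \<Longrightarrow> (i, s) \<notin> W \<Longrightarrow>
       (\<forall>\<^sub>F u in nhds s. s < u \<longrightarrow> b i s < b i u) \<or> (\<forall>\<^sub>F u in nhds s. u < s \<longrightarrow> b i s < b i u)"
    by (rule diagram_height_functions[OF D, folded len]) (rule that, assumption+)
  obtain L'' gs' where L'L'': "ambient_isotopic L' L''" and gs': "parametrises_link gs' L''"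
    and len': "length gs' = length gs"
    and heights: "\<And>i s. i < length gs \<Longrightarrow> s \<in> {0..1} \<Longrightarrow> height ((gs' ! i) s) = b i s"
    by (rule realise_heights[OF D gs len, where b = b])
      ((rule proj over b_pl b_loop b_over; assumption)+, rule that, assumption+)
  have b_cont: "continuous_on {0..1} (b i)" if "i < length gs" for i
    using b_pl[OF that] by (simp add: pl_path_def path_def)
  have "height_generic L''"
    by (rule height_genericI[OF gs', unfolded len', OF heights b_cont b_iso])
  moreover have "ambient_isotopic L L''"
    by (rule ambient_isotopic_trans[OF LL' L'L''])
  ultimately have le: "bridge_number L \<le> enat (card (local_maxima L''))"
    unfolding bridge_number_def link_with_components_def using gs' by (intro Inf_lower) blast
  have "card (local_maxima L'') \<le> length gs + card W"
    by (rule card_local_maxima_le[OF gs', unfolded len', OF heights W(1) b_climb])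
  then have "enat (card (local_maxima L'')) \<le>
      enat (diagram_ascending_number D + length (curves D))"
    using W(2) len by simp
  with le show ?thesis by (rule order_trans)
qed

text \<open>A diagram projects some isotopic copy of the link, so its number of curves is tied to
  \<open>n\<close> only through the invariance of the component count.\<close>

lemma diagram_of_length_le:
  assumes "diagram_of D L" "link_with_components n L"
  shows "length (curves D) \<le> n"
proof -
  obtain hs where hs: "length hs = n" "parametrises_link hs L"
    using assms(2) by (auto simp: link_with_components_def)
  obtain L' gs where "ambient_isotopic L L'" "parametrises_link gs L'" "length gs = length (curves D)"
    using assms(1) unfolding diagram_of_def by blast
  then show ?thesis using ambient_isotopic_length_le[OF _ hs(2)] hs(1) by metis
qed

theorem theorem2p2:
  fixes n :: nat and L :: "(real^3) set"
  assumes "n \<ge> 1"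
    and "link_with_components n L"
  shows "ascending_number L \<ge> bridge_number L - enat n"
  unfolding ascending_number_def
proof (rule Inf_greatest)
  fix x assume "x \<in> {enat (diagram_ascending_number D) | D. diagram_of D L}"
  then obtain D where D: "diagram_of D L" and x: "x = enat (diagram_ascending_number D)" by blast
  have "bridge_number L \<le> enat (diagram_ascending_number D + length (curves D))"
    by (rule bridge_number_le_diagram[OF D])
  also have "\<dots> \<le> enat (diagram_ascending_number D + n)"
    using diagram_of_length_le[OF D assms(2)] by simp
  finally show "bridge_number L - enat n \<le> x"
    \<comment> \<open>The bound excludes an infinite bridge number, and truncated subtraction is
      harmless since \<open>x\<close> is nonnegative.\<close>
    unfolding x by (cases "bridge_number L") auto
qed

end
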